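(* Let $\delta\ge 0$, let $\{L_{\delta,f}\}_{f\in B_w}$ be a family of Markov bounded operators $L_{\delta,f}:B_w\to B_w$ preserving $B_s$ and $B_{ss}$, and let $\mathcal{L}_\delta(f):=L_{\delta,f}(f)$ be the associated self-consistent transfer operator. Assume: (a) (fixed point) there is $h\in B_{ss}\cap P_w$ with $\mathcal{L}_\delta h=h$; (b) (boundedness) there is $C\ge 0$ such that for each $f\in B_w$: $\|L_{\delta,f}\|_{w\to w}\le C$, $\|L_{\delta,f}\|_{s\to s}\le C$, $\|L_{\delta,f}\|_{ss\to ss}\le C$; (c) (sequential Lasota-Yorke inequalities) there are $\lambda_0<1$ and $A,B>0$ such that for each $n\in\mathbb{N}$, all $f_1,\dots,f_n\in P_w$ and $g\in B_s$ $$\|L_{\delta,f_1}\circ\dots\circ L_{\delta,f_n}(g)\|_w\le B\|g\|_w,\qquad \|L_{\delta,f_1}\circ\dots\circ L_{\delta,f_n}(g)\|_s\le A\lambda_0^n\|g\|_s+B\|g\|_w;$$ (d) (convergence to equilibrium for $L_{\delta,h}$) there are $a_n\ge 0$ with $a_n\to 0$ such that $\|L_{\delta,h}^n(\mu)\|_w\le a_n\|\mu\|_s$ for all $n\in\mathbb{N}$ and $\mu\in V_s$; (e) (regularity of the family) there is $C_0>0$ such that for all $f,g\in B_s$ $$\|L_{\delta,f}(h)-L_{\delta,g}(h)\|_s\le \delta C_0\|h\|_{ss}\|f-g\|_w,$$ and there is $C_1>0$ such that for all $f_1,f_2\in B_w$ and $g\in B_s$ $$\|L_{\delta,f_1}(g)-L_{\delta,f_2}(g)\|_w\le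 \delta C_1\|g\|_s\|f_1-f_2\|_w;$$ (f) (differentiability at $h$) there is a bounded linear operator $\partial L_{\delta,h}:(V_w,\|\cdot\|_w)\to (V_s,\|\cdot\|_s)$ such that $$\lim_{g\in V_w,\ \|g\|_w\to 0}\frac{\|L_{\delta,h+g}(h)-L_{\delta,h}(h)-\partial L_{\delta,h}(g)\|_s}{\|g\|_w}=0.$$ Let $d\mathcal{L}_{\delta,h}:=L_{\delta,h}+\partial L_{\delta,h}:V_s\to V_s$ be the differential of $\mathcal{L}_\delta$ at $h$. Assume furthermore that 1. $\partial L_{\delta,h}$ takes values in $B_{ss}$ and is bounded as an operator $(V_w,\|\cdot\|_w)\to(B_{ss},\|\cdot\|_{ss})$; 2. there are $n\in\mathbb{N}$ and a positive real $\lambda<1$ such that $\|d\mathcal{L}_{\delta,h}^n(g)\|_s\le\lambda\|g\|_s$ for all $g\in V_s$. Then the system has local strong contraction to $h$: there are $\epsilon>0$ and $\gamma,K>0$ such that for each $\mu\in P_s$ with $\|h-\mu\|_s\le\epsilon$ and each $n\in\mathbb{N}$ $$\|h-\mathcal{L}_\delta^n(\mu)\|_s\le Ke^{-\gamma n}\|h-\mu\|_s.$$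
   Context: $X$ is a metric space, $P(X)$ the set of Borel probability measures on $X$, $SM(X)$ the vector space of signed Borel measures on $X$. Fix normed vector subspaces $(B_{ss},\|\cdot\|_{ss})\subseteq(B_s,\|\cdot\|_s)\subseteq(B_w,\|\cdot\|_w)\subseteq SM(X)$ with $\|\cdot\|_{ss}\ge\|\cdot\|_s\ge\|\cdot\|_w$ (on the spaces where both sides are defined). Set $P_w:=P(X)\cap B_w$, $P_s:=P(X)\cap B_s$, $V_w:=\{\mu\in B_w:\mu(X)=0\}$, $V_s:=V_w\cap B_s$. For $\tau,\tau'\in\{ss,s,w\}$, $\|\cdot\|_{\tau\to\tau'}$ is the operator norm from $B_\tau$ to $B_{\tau'}$. A Markov operator is a linear operator mapping positive measures to positive measures and preserving total mass $\mu(X)$. The operator $\mathcal{L}_\delta$ maps $P_w$ to $P_w$, and the same formula $\mathcal{L}_\delta(f)=L_{\delta,f}(f)$ is used for $f\in B_w$. The operator $d\mathcal{L}_{\delta,h}$ is the differential of $\mathcal{L}_\delta$ at $h$ in the sense that $\|\mathcal{L}_\delta(h+g)-\mathcal{L}_\delta(h)-d\mathcal{L}_{\delta,h}(g)\|_w/\|g\|_s\to 0$ as $\|g\|_s\to 0$, $g\in V_s$. *)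

theory Defs
  imports "HOL-Probability.Probability" "HOL-Library.Going_To_Filter"
begin

text \<open>
  A (finite) signed Borel measure is a real-valued countably additive function on the Borel sets.
  Since HOL functions are total, it is set to 0 on the other sets, so that equality of measures is
  equality on Borel sets.
\<close>

typedef (overloaded) 'a smeasure =
  "{m :: 'a::topological_space set \<Rightarrow> real.
      (\<forall>A. A \<notin> sets borel \<longrightarrow> m A = 0) \<and>
      (\<forall>A :: nat \<Rightarrow> 'a set. range A \<subseteq> sets borel \<longrightarrow> disjoint_family A \<longrightarrow>
          (\<lambda>i. m (A i)) sums m (\<Union>i. A i))}"
  morphisms smeas Abs_smeasure
  by (rule exI[of _ "\<lambda>_. 0"]) auto

setup_lifting type_definition_smeasure

lemma smeasure_eqI: "(\<And>A. A \<in> sets borel \<Longrightarrow> smeas \<mu> A = smeas \<nu> A) \<Longrightarrow> \<mu> = \<nu>"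
  by transfer (metis ext)

instantiation smeasure :: (topological_space) real_vector
begin

lift_definition zero_smeasure :: "'a smeasure" is "\<lambda>_. 0"
  by simp

lift_definition plus_smeasure :: "'a smeasure \<Rightarrow> 'a smeasure \<Rightarrow> 'a smeasure"
  is "\<lambda>m n A. m A + n A"
  by (auto intro!: sums_add)

lift_definition minus_smeasure :: "'a smeasure \<Rightarrow> 'a smeasure \<Rightarrow> 'a smeasure"
  is "\<lambda>m n A. m A - n A"
  by (auto intro!: sums_diff)

lift_definition uminus_smeasure :: "'a smeasure \<Rightarrow> 'a smeasure"
  is "\<lambda>m A. - m A"
  by (auto intro!: sums_minus)

lift_definition scaleR_smeasure :: "real \<Rightarrow> 'a smeasure \<Rightarrow> 'a smeasure"
  is "\<lambda>c m A. c * m A"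
  by (auto intro!: sums_mult)

instance
  by standard (transfer; simp add: fun_eq_iff algebra_simps)+

end

definition total_mass :: "'a::topological_space smeasure \<Rightarrow> real" where
  "total_mass \<mu> = smeas \<mu> UNIV"

definition positive_smeasure :: "'a::topological_space smeasure \<Rightarrow> bool" where
  "positive_smeasure \<mu> \<longleftrightarrow> (\<forall>A\<in>sets borel. 0 \<le> smeas \<mu> A)"

definition borel_probs :: "'a::topological_space smeasure set" where
  "borel_probs = {\<mu>. \<exists>M. prob_space M \<and> sets M = sets borel \<and>
                        (\<forall>A\<in>sets borel. smeas \<mu> A = measure M A)}"

lemma borel_probs_iff: "\<mu> \<in> borel_probs \<longleftrightarrow> positive_smeasure \<mu> \<and> total_mass \<mu> = 1"
proof
  assume "\<mu> \<in> borel_probs"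
  then obtain M where M: "prob_space M" "sets M = sets borel"
      "\<forall>A\<in>sets borel. smeas \<mu> A = measure M A"
    by (auto simp: borel_probs_def)
  have "space M = UNIV"
    using M(2) by (metis sets_eq_imp_space_eq space_borel)
  then have "smeas \<mu> UNIV = 1"
    using M prob_space.prob_space[of M] by auto
  with M show "positive_smeasure \<mu> \<and> total_mass \<mu> = 1"
    by (auto simp: positive_smeasure_def total_mass_def)
next
  assume *: "positive_smeasure \<mu> \<and> total_mass \<mu> = 1"
  define M where "M = measure_of UNIV (sets borel) (\<lambda>A. ennreal (smeas \<mu> A))"
  have sums: "(\<lambda>i. smeas \<mu> (A i)) sums smeas \<mu> (\<Union>i. A i)"
    if "range A \<subseteq> sets borel" "disjoint_family A" for A :: "nat \<Rightarrow> 'a set"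
    using smeas[of \<mu>] that by blast
  have empty: "smeas \<mu> {} = 0"
    using sums[of "\<lambda>_. {}"] by (auto simp: disjoint_family_on_def sums_iff summable_const_iff)
  have sets: "sets M = sets borel"
    unfolding M_def by (metis sets.sets_measure_of_eq space_borel)
  have em: "emeasure M A = ennreal (smeas \<mu> A)" if "A \<in> sets borel" for A
  proof (rule emeasure_measure_of[OF M_def])
    show "countably_additive (sets M) (\<lambda>A. ennreal (smeas \<mu> A))"
      unfolding countably_additive_def sets
    proof (intro allI impI)
      fix A :: "nat \<Rightarrow> 'a set"
      assume A: "range A \<subseteq> sets borel" "disjoint_family A"
      have "0 \<le> smeas \<mu> (A i)" for i
        using * A(1) by (auto simp: positive_smeasure_def)
      then show "(\<Sum>i. ennreal (smeas \<mu> (A i))) = ennreal (smeas \<mu> (\<Union>i. A i))"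
        using sums[OF A] by (intro suminf_ennreal_eq)
    qed
  qed (use that empty sets in \<open>auto simp: positive_def\<close>)
  have "space M = UNIV"
    using sets by (metis sets_eq_imp_space_eq space_borel)
  then have "prob_space M"
    using em[of UNIV] * by (intro prob_spaceI) (auto simp: total_mass_def)
  moreover have "smeas \<mu> A = measure M A" if "A \<in> sets borel" for A
    using em[OF that] * that by (simp add: measure_def positive_smeasure_def)
  ultimately show "\<mu> \<in> borel_probs"
    using sets by (auto simp: borel_probs_def)
qed

definition zero_mass :: "'a::topological_space smeasure set \<Rightarrow> 'a smeasure set" where
  "zero_mass V = {\<mu>\<in>V. total_mass \<mu> = 0}"

text \<open>
  A norm on a subspace is a function on the whole ambient space of which only the values
  on the subspace matter.
\<close>

definition normed_subspace :: "'v::real_vector set \<Rightarrow> ('v \<Rightarrow> real) \<Rightarrow> bool" where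
  "normed_subspace V N \<longleftrightarrow> subspace V \<and>
     (\<forall>x\<in>V. N x = 0 \<longleftrightarrow> x = 0) \<and>
     (\<forall>x\<in>V. \<forall>y\<in>V. N (x + y) \<le> N x + N y) \<and>
     (\<forall>c. \<forall>x\<in>V. N (c *\<^sub>R x) = \<bar>c\<bar> * N x)"

lemma normed_subspace_nonneg:
  assumes "normed_subspace V N" "x \<in> V"
  shows "0 \<le> N x"
proof -
  have "0 = N (x + (- 1) *\<^sub>R x)" "(- 1) *\<^sub>R x \<in> V"
    using assms subspace_0[of V] subspace_scale[of V x "-1"]
    by (auto simp: normed_subspace_def)
  moreover have "N ((- 1) *\<^sub>R x) = N x"
    using assms by (simp only: normed_subspace_def)
  ultimately show ?thesis
    using assms by (smt (verit) normed_subspace_def)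
qed

definition linear_between :: "'v::real_vector set \<Rightarrow> 'w::real_vector set \<Rightarrow> ('v \<Rightarrow> 'w) \<Rightarrow> bool" where
  "linear_between V W T \<longleftrightarrow> T ` V \<subseteq> W \<and>
     (\<forall>x\<in>V. \<forall>y\<in>V. T (x + y) = T x + T y) \<and>
     (\<forall>c. \<forall>x\<in>V. T (c *\<^sub>R x) = c *\<^sub>R T x)"

text \<open>
  The operator norm takes values in the extended reals, so that it is \<open>\<infinity>\<close> exactly for
  unbounded operators. The quotient is 0 at the zero vector because \<open>x / 0 = 0\<close>.
\<close>

definition op_norm :: "'v set \<Rightarrow> ('v \<Rightarrow> real) \<Rightarrow> ('w \<Rightarrow> real) \<Rightarrow> ('v \<Rightarrow> 'w) \<Rightarrow> ereal" where
  "op_norm V N N' T = (SUP x\<in>V. ereal (N' (T x) / N x))"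

lemma op_norm_le_iff:
  assumes "normed_subspace V N" "normed_subspace W N'" "linear_between V W T" "0 \<le> C"
  shows "op_norm V N N' T \<le> ereal C \<longleftrightarrow> (\<forall>x\<in>V. N' (T x) \<le> C * N x)"
proof -
  have "N' (T x) / N x \<le> C \<longleftrightarrow> N' (T x) \<le> C * N x" if x: "x \<in> V" for x
  proof (cases "x = 0")
    case True
    have "T (0 *\<^sub>R x) = 0 *\<^sub>R T x"
      using assms(3) x by (simp only: linear_between_def)
    then have "T x = 0"
      using True by simp
    moreover have "T x \<in> W"
      using assms(3) x by (auto simp: linear_between_def)
    ultimately have "N' (T x) = 0" "N x = 0"
      using True assms(1,2) x by (auto simp: normed_subspace_def)
    then show ?thesis
      using \<open>0 \<le> C\<close> by simp
  next
    case False
    then have "N x > 0"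
      using assms(1) x normed_subspace_nonneg[OF assms(1) x] by (auto simp: normed_subspace_def less_le)
    then show ?thesis
      by (simp add: pos_divide_le_eq)
  qed
  then show ?thesis
    by (auto simp: op_norm_def SUP_le_iff)
qed

definition bounded_linear_between ::
  "'v::real_vector set \<Rightarrow> ('v \<Rightarrow> real) \<Rightarrow> 'w::real_vector set \<Rightarrow> ('w \<Rightarrow> real) \<Rightarrow> ('v \<Rightarrow> 'w) \<Rightarrow> bool" where
  "bounded_linear_between V N W N' T \<longleftrightarrow> linear_between V W T \<and> op_norm V N N' T < \<infinity>"

definition markov_operator ::
  "'a::topological_space smeasure set \<Rightarrow> ('a smeasure \<Rightarrow> 'a smeasure) \<Rightarrow> bool" where
  "markov_operator V T \<longleftrightarrow> linear_between V V T \<and>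
     (\<forall>\<mu>\<in>V. positive_smeasure \<mu> \<longrightarrow> positive_smeasure (T \<mu>)) \<and>
     (\<forall>\<mu>\<in>V. total_mass (T \<mu>) = total_mass \<mu>)"

definition self_consistent :: "('v \<Rightarrow> 'v \<Rightarrow> 'v) \<Rightarrow> 'v \<Rightarrow> 'v" where
  "self_consistent L f = L f f"

end

theory Submission
  imports Defs
begin

text \<open>
  Put \<open>T = L h + D\<close> and let \<open>u\<^sub>n\<close> be the distance vector from \<open>h\<close> to the \<open>n\<close>-th iterate. Replacing
  \<open>L \<mu>\<close> by \<open>L h\<close> costs a quadratic error, but only in the weak norm. Hence, for fixed \<open>n\<close> and a starting
  point close to \<open>h\<close>, the vector \<open>u\<^sub>n\<close> is weakly \<open>\<eta> \<parallel>u\<^sub>0\<parallel>\<^sub>s\<close>-close to \<open>T\<^sup>n u\<^sub>0\<close>, which is exponentially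
  small in the strong norm. On the next \<open>n\<close> steps the sequential Lasota-Yorke inequality, applied to
  \<open>u\<^sub>n\<^sub>+\<^sub>1 = L \<mu>\<^sub>n u\<^sub>n + (L \<mu>\<^sub>n h - h)\<close> with \<open>\<parallel>L \<mu>\<^sub>n h - h\<parallel>\<^sub>s \<le> c \<parallel>u\<^sub>n\<parallel>\<^sub>w\<close>, turns this weak smallness into
  strong smallness. So \<open>2 n\<close> steps contract a strong ball around \<open>h\<close> by the factor \<open>1 / 2\<close>.
\<close>

section \<open>Normed subspaces, linear maps between them, zero-mass measures\<close>

lemma normed_subspace_imp_subspace: "normed_subspace V N \<Longrightarrow> subspace V"
  by (simp add: normed_subspace_def)

lemma normed_subspace_triangle:
  "normed_subspace V N \<Longrightarrow> x \<in> V \<Longrightarrow> y \<in> V \<Longrightarrow> N (x + y) \<le> N x + N y"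
  by (simp add: normed_subspace_def)

lemma normed_subspace_minus_commute:
  assumes "normed_subspace V N" "x \<in> V" "y \<in> V"
  shows "N (x - y) = N (y - x)"
proof -
  have "y - x \<in> V"
    using assms by (simp add: normed_subspace_def subspace_diff)
  then have "N ((- 1) *\<^sub>R (y - x)) = \<bar>- 1\<bar> * N (y - x)"
    using assms(1) unfolding normed_subspace_def by blast
  then show ?thesis
    by simp
qed

lemma linear_between_diff:
  assumes "linear_between V W T" "subspace V" "x \<in> V" "y \<in> V"
  shows "T (x - y) = T x - T y"
proof -
  have *: "(- 1) *\<^sub>R y \<in> V"
    using assms by (intro subspace_scale)
  have "T (x + (- 1) *\<^sub>R y) = T x + T ((- 1) *\<^sub>R y)"
    using assms(1,3) * unfolding linear_between_def by blast
  also have "T ((- 1) *\<^sub>R y) = (- 1) *\<^sub>R T y"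
    using assms(1,4) unfolding linear_between_def by blast
  finally show ?thesis
    by simp
qed

lemma linear_between_zero:
  assumes "linear_between V W T" "subspace V"
  shows "T 0 = 0"
  using linear_between_diff[OF assms subspace_0[OF assms(2)] subspace_0[OF assms(2)]] by simp

lemma bounded_linear_betweenE:
  assumes "normed_subspace V N" "normed_subspace W N'" "bounded_linear_between V N W N' T"
  obtains d where "0 \<le> d" "\<forall>x\<in>V. N' (T x) \<le> d * N x"
proof -
  have T: "linear_between V W T" and "op_norm V N N' T < \<infinity>"
    using assms(3) by (auto simp: bounded_linear_between_def)
  then obtain r where "op_norm V N N' T \<le> ereal r"
    using ereal_dense2 less_imp_le by blast
  \<comment> \<open>Comparing the operator norm with a pointwise bound requires a nonnegative
    constant, hence the maximum with 0.\<close>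
  then have "op_norm V N N' T \<le> ereal (max r 0)"
    by (meson ereal_less_eq(3) max.cobounded1 order_trans)
  then show ?thesis
    using that[of "max r 0"] op_norm_le_iff[OF assms(1,2) T, of "max r 0"] by simp
qed

lemma zero_mass_subspace:
  assumes "subspace V"
  shows "subspace (zero_mass V)"
  using assms
  by (auto simp: zero_mass_def subspace_def total_mass_def zero_smeasure.rep_eq
      plus_smeasure.rep_eq scaleR_smeasure.rep_eq)

lemma total_mass_diff: "total_mass (x - y) = total_mass x - total_mass y"
  by (simp add: total_mass_def minus_smeasure.rep_eq)

lemma zero_mass_normed_subspace: "normed_subspace V N \<Longrightarrow> normed_subspace (zero_mass V) N"
  using zero_mass_subspace[of V] by (auto simp: normed_subspace_def zero_mass_def)

lemma funpow_mem: "(\<And>x. x \<in> S \<Longrightarrow> f x \<in> S) \<Longrightarrow> x \<in> S \<Longrightarrow> (f ^^ n) x \<in> S"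
  by (induction n) auto

section \<open>From one contracting iterate to exponential decay\<close>

text \<open>Write \<open>n = s + q * N\<close> with \<open>s < N\<close>: the \<open>q\<close> full
  blocks contribute \<open>r ^ q\<close>, the remaining \<open>s\<close> steps cost at most
  \<open>R ^ N\<close>. No linearity enters, so the argument serves both the linearized map and the
  nonlinear one. Invariance of \<open>S\<close> is asked of \<open>f ^^ N\<close> only, because a
  small ball need not be preserved by single steps.\<close>

lemma exponential_decay_of_contracting_iterate:
  fixes f :: "'b \<Rightarrow> 'b" and \<phi> :: "'b \<Rightarrow> real"
  assumes N: "0 < N"
    and r: "0 < r" "r < 1" and R: "1 \<le> R"
    and inv: "\<And>x. x \<in> S \<Longrightarrow> (f ^^ N) x \<in> S"
    and nonneg: "\<And>x. x \<in> S \<Longrightarrow> 0 \<le> \<phi> x"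
    and contr: "\<And>x. x \<in> S \<Longrightarrow> \<phi> ((f ^^ N) x) \<le> r * \<phi> x"
    and growth: "\<And>x j. x \<in> S \<Longrightarrow> \<phi> ((f ^^ j) x) \<le> R ^ j * \<phi> x"
  shows "\<exists>\<gamma>>0. \<exists>K>0. \<forall>x\<in>S. \<forall>n. \<phi> ((f ^^ n) x) \<le> K * exp (- \<gamma> * real n) * \<phi> x"
proof -
  \<comment> \<open>The rate is chosen so that \<open>r ^ q = exp (- \<gamma> * (q * N))\<close>. In
    the constant \<open>K\<close> below, \<open>R ^ N\<close> pays for the incomplete block and
    \<open>exp (\<gamma> * N)\<close> for replacing \<open>q * N\<close> by \<open>n\<close>, since
    \<open>n \<le> N + q * N\<close>.\<close>
  define \<gamma> where "\<gamma> = - ln r / N"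
  have \<gamma>: "\<gamma> > 0"
    using r N by (simp add: \<gamma>_def divide_neg_pos)
  define K where "K = R ^ N * exp (\<gamma> * N)"
  have K: "K > 0"
    using R by (simp add: K_def)
  have block: "(f ^^ (q * N)) x \<in> S \<and> \<phi> ((f ^^ (q * N)) x) \<le> r ^ q * \<phi> x" if x: "x \<in> S" for x q
  proof (induction q)
    case 0
    then show ?case using x by simp
  next
    case (Suc q)
    have eq: "(f ^^ (Suc q * N)) x = (f ^^ N) ((f ^^ (q * N)) x)"
      by (simp add: funpow_add)
    have "\<phi> ((f ^^ N) ((f ^^ (q * N)) x)) \<le> r * \<phi> ((f ^^ (q * N)) x)"
      using Suc contr by blast
    also have "\<dots> \<le> r * (r ^ q * \<phi> x)"
      using Suc r by (intro mult_left_mono) auto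
    finally show ?case
      using Suc inv unfolding eq by (simp add: mult.assoc)
  qed
  have "\<phi> ((f ^^ n) x) \<le> K * exp (- \<gamma> * n) * \<phi> x" if x: "x \<in> S" for x n
  proof -
    define q where "q = n div N"
    have n: "n = n mod N + q * N"
      by (simp add: q_def)
    have "(f ^^ n) x = (f ^^ (n mod N)) ((f ^^ (q * N)) x)"
      by (subst n) (simp only: funpow_add o_apply)
    then have "\<phi> ((f ^^ n) x) \<le> R ^ (n mod N) * \<phi> ((f ^^ (q * N)) x)"
      using growth block[OF x, of q] by metis
    also have "\<dots> \<le> R ^ N * (r ^ q * \<phi> x)"
      using block[OF x, of q] nonneg[of "(f ^^ (q * N)) x"] R N
      by (intro mult_mono power_increasing) (auto simp: less_imp_le)
    also have "r ^ q = exp (- \<gamma> * (q * N))"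
    proof -
      have "r ^ q = exp (q * ln r)"
        using r by (simp add: exp_of_nat_mult)
      then show ?thesis
        using N by (simp add: \<gamma>_def mult.commute)
    qed
    also have "R ^ N * (exp (- \<gamma> * (q * N)) * \<phi> x) \<le> R ^ N * (exp (\<gamma> * N - \<gamma> * n) * \<phi> x)"
    proof -
      have "n \<le> N + q * N"
        using n N by (metis add_mono less_imp_le mod_less_divisor order_refl)
      then have "real n \<le> real N + real q * real N"
        by (metis of_nat_add of_nat_le_iff of_nat_mult)
      then have "\<gamma> * real n \<le> \<gamma> * (real N + real q * real N)"
        using \<gamma> by (intro mult_left_mono) auto
      then show ?thesis
        using R nonneg[OF x] by (intro mult_left_mono mult_right_mono) (auto simp: algebra_simps)
    qed
    also have "\<dots> = K * exp (- \<gamma> * n) * \<phi> x"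
      by (simp add: K_def exp_diff exp_minus divide_simps)
    finally show ?thesis .
  qed
  with \<gamma> K show ?thesis by blast
qed

section \<open>The abstract self-consistent system\<close>

text \<open>This separates the analysis from measure theory. \<open>P\<close> stands for the
  probability measures in the strong space and \<open>Vw\<close> for the zero-mass part of the weak
  space. Positivity and mass survive only as \<open>P_inv\<close> and \<open>P_diff\<close>;
  operator norms and limits are replaced by explicit constants and estimates, and the Lasota-Yorke
  rate is taken nonnegative.\<close>

locale self_consistent_system =
  fixes Bs Bw Vw P :: "'v::real_vector set"
    and ns nw :: "'v \<Rightarrow> real"
    and L :: "'v \<Rightarrow> 'v \<Rightarrow> 'v" and h :: 'v and D :: "'v \<Rightarrow> 'v"
    and C c c\<^sub>1 d A B lam :: real
  assumes Bs: "normed_subspace Bs ns" and Bw: "normed_subspace Bw nw"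
    and Bs_Bw: "Bs \<subseteq> Bw" and nw_le_ns: "x \<in> Bs \<Longrightarrow> nw x \<le> ns x"
    and Vw: "subspace Vw" "Vw \<subseteq> Bw"
    and h: "h \<in> P" "L h h = h"
    and P_Bs: "P \<subseteq> Bs" and P_diff: "x \<in> P \<Longrightarrow> y \<in> P \<Longrightarrow> x - y \<in> Vw"
    and P_inv: "x \<in> P \<Longrightarrow> L x x \<in> P"
    and L_Bs: "x \<in> P \<Longrightarrow> linear_between Bs Bs (L x)"
    and Lh_Vw: "linear_between Vw Vw (L h)"
    and const_bounds: "0 \<le> C" "0 \<le> c" "0 \<le> c\<^sub>1" "0 \<le> d" "0 \<le> A" "0 \<le> B" "0 \<le> lam" "lam < 1"
    and L_bound: "x \<in> P \<Longrightarrow> g \<in> Bs \<Longrightarrow> ns (L x g) \<le> C * ns g"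
    and Lh_bound_w: "g \<in> Vw \<Longrightarrow> nw (L h g) \<le> C * nw g"
    and D_lin: "linear_between Vw (Vw \<inter> Bs) D"
    and D_bound: "g \<in> Vw \<Longrightarrow> ns (D g) \<le> d * nw g"
    and lasota_yorke: "set fs \<subseteq> P \<Longrightarrow> g \<in> Bs \<Longrightarrow>
      ns (foldr L fs g) \<le> A * lam ^ length fs * ns g + B * nw g"
    and lipschitz_s: "x \<in> P \<Longrightarrow> ns (L x h - h) \<le> c * nw (x - h)"
    and lipschitz_w: "x \<in> P \<Longrightarrow> g \<in> Bs \<Longrightarrow> nw (L x g - L h g) \<le> c\<^sub>1 * ns g * nw (x - h)"
    and differentiable: "0 < \<eta> \<Longrightarrow>
      \<exists>\<rho>>0. \<forall>x\<in>P. nw (x - h) \<le> \<rho> \<longrightarrow> ns (L x h - h - D (x - h)) \<le> \<eta> * nw (x - h)"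
begin

abbreviation S :: "'v \<Rightarrow> 'v" where "S \<equiv> self_consistent L"

definition T :: "'v \<Rightarrow> 'v" where "T u = L h u + D u"

lemma P_sub: "x \<in> P \<Longrightarrow> x - h \<in> Vw" "x \<in> P \<Longrightarrow> x - h \<in> Bs" "x \<in> P \<Longrightarrow> x - h \<in> Bw"
  using P_diff[OF _ h(1)] P_Bs h(1) Bs_Bw subspace_diff[OF normed_subspace_imp_subspace[OF Bs], of x h]
  by auto

lemma S_mem: "x \<in> P \<Longrightarrow> S x \<in> P"
  using P_inv by (simp add: self_consistent_def)

lemma S_iterate_mem: "x \<in> P \<Longrightarrow> (S ^^ n) x \<in> P"
  using S_mem by (rule funpow_mem)

text \<open>Linearity of \<open>L x\<close> splits the new difference into the old one, transported
  by the operator frozen at \<open>x\<close>, and a forcing term \<open>L x h - h\<close>, whose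
  strong norm is controlled by the weak norm of \<open>x - h\<close>.\<close>

lemma S_step: "x \<in> P \<Longrightarrow> S x - h = L x (x - h) + (L x h - h)"
  using linear_between_diff[OF L_Bs normed_subspace_imp_subspace[OF Bs], of x x h]
    subsetD[OF P_Bs] h(1)
  by (simp add: self_consistent_def)

lemma L_mem: "x \<in> P \<Longrightarrow> g \<in> Bs \<Longrightarrow> L x g \<in> Bs"
  using L_Bs[of x] by (auto simp: linear_between_def)

lemma forcing_mem: "x \<in> P \<Longrightarrow> L x h - h \<in> Bs"
  using L_mem[of x h] P_Bs h(1) subspace_diff[OF normed_subspace_imp_subspace[OF Bs]] by auto

lemma ns_nonneg: "x \<in> Bs \<Longrightarrow> 0 \<le> ns x" and nw_nonneg: "x \<in> Bw \<Longrightarrow> 0 \<le> nw x"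
  using normed_subspace_nonneg Bs Bw by blast+

section \<open>Growth bounds for the nonlinear map and its linearization\<close>

text \<open>Transport contributes \<open>C\<close> and forcing contributes \<open>c\<close>. The
  summand 1 makes the factor at least 1, so that its powers increase with the exponent.\<close>

lemma S_growth_step:
  assumes "x \<in> P"
  shows "ns (S x - h) \<le> (C + c + 1) * ns (x - h)"
proof -
  have "ns (S x - h) \<le> ns (L x (x - h)) + ns (L x h - h)"
    unfolding S_step[OF assms]
    by (intro normed_subspace_triangle[OF Bs] L_mem P_sub forcing_mem assms)
  also have "\<dots> \<le> C * ns (x - h) + c * ns (x - h)"
    using L_bound[OF assms P_sub(2)] lipschitz_s[OF assms] assms
      mult_left_mono[OF nw_le_ns[OF P_sub(2)] const_bounds(2)]
    by (meson add_mono order_trans)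
  also have "\<dots> \<le> (C + c + 1) * ns (x - h)"
    using ns_nonneg[OF P_sub(2)[OF assms]] by (simp add: algebra_simps)
  finally show ?thesis .
qed

lemma S_growth:
  assumes "x \<in> P"
  shows "ns ((S ^^ n) x - h) \<le> (C + c + 1) ^ n * ns (x - h)"
proof (induction n)
  case (Suc n)
  have "ns (S ((S ^^ n) x) - h) \<le> (C + c + 1) * ns ((S ^^ n) x - h)"
    by (intro S_growth_step S_iterate_mem assms)
  also have "\<dots> \<le> (C + c + 1) * ((C + c + 1) ^ n * ns (x - h))"
    using Suc const_bounds by (intro mult_left_mono) auto
  finally show ?case
    by (simp add: mult.assoc)
qed simp

lemma T_Vw: "linear_between Vw Vw T"
  using Lh_Vw D_lin subspace_add[OF Vw(1)]
  by (auto simp: linear_between_def T_def scaleR_right_distrib image_subset_iff)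

lemma T_Bs: "g \<in> Vw \<inter> Bs \<Longrightarrow> T g \<in> Vw \<inter> Bs"
  using T_Vw D_lin L_mem[OF h(1), of g] subspace_add[OF normed_subspace_imp_subspace[OF Bs]]
  by (auto simp: linear_between_def T_def)

text \<open>\<open>D\<close> takes the weak norm to the strong norm, which dominates the weak one.
  So \<open>T\<close> is bounded for the weak norm as well, and errors known only weakly can be
  propagated by it.\<close>

lemma T_bound_w:
  assumes "g \<in> Vw"
  shows "nw (T g) \<le> (C + d) * nw g"
proof -
  have D: "D g \<in> Bs" and Lg: "L h g \<in> Bw"
    using assms D_lin Lh_Vw Vw(2) by (auto simp: linear_between_def)
  have "nw (T g) \<le> nw (L h g) + nw (D g)"
    unfolding T_def using D Bs_Bw Lg by (intro normed_subspace_triangle[OF Bw]) auto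
  then show ?thesis
    using Lh_bound_w[OF assms] D_bound[OF assms] nw_le_ns[OF D] by (simp add: algebra_simps)
qed

lemma T_bound_s:
  assumes "g \<in> Vw \<inter> Bs"
  shows "ns (T g) \<le> (C + d + 1) * ns g"
proof -
  have D: "D g \<in> Bs"
    using assms D_lin by (auto simp: linear_between_def)
  have "ns (T g) \<le> ns (L h g) + ns (D g)"
    unfolding T_def using D assms L_mem h(1) by (intro normed_subspace_triangle[OF Bs]) auto
  also have "\<dots> \<le> C * ns g + d * ns g"
    using L_bound[OF h(1), of g] D_bound[of g] assms mult_left_mono[OF nw_le_ns[of g] const_bounds(4)]
    by (intro add_mono) auto
  also have "\<dots> \<le> (C + d + 1) * ns g"
    using ns_nonneg[of g] assms by (simp add: algebra_simps)
  finally show ?thesis .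
qed

section \<open>Differentiability of the iterates, measured in the weak norm\<close>

text \<open>With \<open>u = x - h\<close>, the error is
  \<open>(L x u - L h u) + (L x h - h - D u)\<close>. The first part is quadratic in
  \<open>u\<close>, but \<open>lipschitz_w\<close> bounds it only weakly; the second is small by
  differentiability at \<open>h\<close>.\<close>

lemma S_weak_differentiable:
  assumes "0 < \<eta>"
  shows "\<exists>\<rho>>0. \<forall>x\<in>P. ns (x - h) \<le> \<rho> \<longrightarrow> nw (S x - h - T (x - h)) \<le> \<eta> * ns (x - h)"
proof -
  obtain \<rho> where \<rho>: "\<rho> > 0"
    "\<And>x. x \<in> P \<Longrightarrow> nw (x - h) \<le> \<rho> \<Longrightarrow> ns (L x h - h - D (x - h)) \<le> \<eta> / 2 * nw (x - h)"
    using differentiable[of "\<eta> / 2"] assms by auto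
  \<comment> \<open>The second radius makes \<open>c\<^sub>1 * ns (x - h) \<le> \<eta> / 2\<close>;
    adding 1 to the constant keeps the denominator positive when it vanishes.\<close>
  define \<rho>' where "\<rho>' = min \<rho> (\<eta> / (2 * (c\<^sub>1 + 1)))"
  have "\<rho>' > 0"
    using \<rho>(1) assms const_bounds by (simp add: \<rho>'_def)
  moreover have "nw (S x - h - T (x - h)) \<le> \<eta> * ns (x - h)" if x: "x \<in> P" "ns (x - h) \<le> \<rho>'" for x
  proof -
    let ?u = "x - h"
    have w: "0 \<le> nw ?u" "nw ?u \<le> ns ?u"
      using nw_nonneg[OF P_sub(3)] nw_le_ns[OF P_sub(2)] x by auto
    have split: "S x - h - T ?u = (L x ?u - L h ?u) + (L x h - h - D ?u)"
      using S_step[OF x(1)] by (simp add: T_def)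
    have Bs_sub: "subspace Bs"
      using Bs by (rule normed_subspace_imp_subspace)
    have mem1: "L x ?u - L h ?u \<in> Bs"
      by (intro subspace_diff[OF Bs_sub] L_mem P_sub x h)
    have mem2: "L x h - h - D ?u \<in> Bs"
      using D_lin P_sub(1)[OF x(1)]
      by (intro subspace_diff[OF Bs_sub] forcing_mem x) (auto simp: linear_between_def)
    have "nw (S x - h - T ?u) \<le> nw (L x ?u - L h ?u) + nw (L x h - h - D ?u)"
      unfolding split using mem1 mem2 Bs_Bw by (intro normed_subspace_triangle[OF Bw]) auto
    also have "\<dots> \<le> c\<^sub>1 * ns ?u * nw ?u + \<eta> / 2 * nw ?u"
      using lipschitz_w[OF x(1) P_sub(2)[OF x(1)]] \<rho>(2)[OF x(1)] nw_le_ns[OF mem2] w x(2)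
      by (simp add: \<rho>'_def)
    also have "c\<^sub>1 * ns ?u \<le> \<eta> / 2"
    proof -
      have "c\<^sub>1 * ns ?u \<le> (c\<^sub>1 + 1) * (\<eta> / (2 * (c\<^sub>1 + 1)))"
        using x(2) w const_bounds by (intro mult_mono) (auto simp: \<rho>'_def)
      also have "\<dots> = \<eta> / 2"
        using const_bounds by (simp add: field_simps)
      finally show ?thesis .
    qed
    also have "\<eta> / 2 * nw ?u + \<eta> / 2 * nw ?u \<le> \<eta> * ns ?u"
      using w assms by simp
    finally show ?thesis
      using w(1) by (simp add: mult_right_mono)
  qed
  ultimately show ?thesis by blast
qed

text \<open>A chain rule by induction: the error after \<open>n + 1\<close> steps is the one-step
  error at \<open>(S ^^ n) x\<close> plus \<open>T\<close> applied to the error after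
  \<open>n\<close> steps. The radius depends on \<open>n\<close>, so this is useful only over a
  fixed number of steps.\<close>

lemma S_iterate_weak_differentiable:
  assumes "0 < \<eta>"
  shows "\<exists>\<rho>>0. \<forall>x\<in>P. ns (x - h) \<le> \<rho> \<longrightarrow>
    nw ((S ^^ n) x - h - (T ^^ n) (x - h)) \<le> \<eta> * ns (x - h)"
  using assms
proof (induction n arbitrary: \<eta>)
  case 0
  have "nw 0 = 0"
    using Bw subspace_0 by (auto simp: normed_subspace_def)
  then show ?case
    using 0 ns_nonneg P_sub by (intro exI[of _ 1]) auto
next
  case (Suc n)
  define R where "R = C + c + 1"
  define R' where "R' = C + d + 1"
  have R: "R \<ge> 1" "R' \<ge> 1"
    using const_bounds by (auto simp: R_def R'_def)
  \<comment> \<open>Each of the two errors receives half of \<open>\<eta>\<close>. The old error is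
    amplified by at most \<open>R'\<close> in the weak norm, and the new one is taken at a point
    whose strong distance to \<open>h\<close> has grown by at most \<open>R ^ n\<close>; the
    tolerances and the radius \<open>\<rho>\<close> compensate for these factors.\<close>
  obtain \<rho>\<^sub>1 where \<rho>\<^sub>1: "\<rho>\<^sub>1 > 0" "\<And>x. x \<in> P \<Longrightarrow> ns (x - h) \<le> \<rho>\<^sub>1 \<Longrightarrow>
      nw ((S ^^ n) x - h - (T ^^ n) (x - h)) \<le> \<eta> / (2 * R') * ns (x - h)"
    using Suc.IH[of "\<eta> / (2 * R')"] Suc.prems R by auto
  obtain \<rho>\<^sub>2 where \<rho>\<^sub>2: "\<rho>\<^sub>2 > 0" "\<And>x. x \<in> P \<Longrightarrow> ns (x - h) \<le> \<rho>\<^sub>2 \<Longrightarrow>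
      nw (S x - h - T (x - h)) \<le> \<eta> / (2 * R ^ n) * ns (x - h)"
    using S_weak_differentiable[of "\<eta> / (2 * R ^ n)"] Suc.prems R by auto
  define \<rho> where "\<rho> = min \<rho>\<^sub>1 (\<rho>\<^sub>2 / R ^ n)"
  have "\<rho> > 0"
    using \<rho>\<^sub>1(1) \<rho>\<^sub>2(1) R by (simp add: \<rho>_def)
  moreover have "nw ((S ^^ Suc n) x - h - (T ^^ Suc n) (x - h)) \<le> \<eta> * ns (x - h)"
    if x: "x \<in> P" "ns (x - h) \<le> \<rho>" for x
  proof -
    let ?u = "x - h" and ?y = "(S ^^ n) x" and ?v = "(T ^^ n) (x - h)"
    have y: "?y \<in> P"
      using x(1) by (rule S_iterate_mem)
    have v: "?v \<in> Vw"
      using T_Vw P_sub(1)[OF x(1)] by (intro funpow_mem[of Vw]) (auto simp: linear_between_def)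
    have yv: "?y - h - ?v \<in> Vw"
      by (intro subspace_diff[OF Vw(1)] P_sub y v)
    have growth: "ns (?y - h) \<le> R ^ n * ns ?u"
      unfolding R_def by (rule S_growth[OF x(1)])
    also have "\<dots> \<le> \<rho>\<^sub>2"
      using x(2) R by (simp add: \<rho>_def field_simps)
    finally have small: "ns (?y - h) \<le> \<rho>\<^sub>2" .
    have split: "(S ^^ Suc n) x - h - (T ^^ Suc n) ?u = (S ?y - h - T (?y - h)) + T (?y - h - ?v)"
      using linear_between_diff[OF T_Vw Vw(1) P_sub(1)[OF y] v] by simp
    have mem: "T (?y - h) \<in> Vw" "T (?y - h - ?v) \<in> Vw"
      using T_Vw P_sub(1)[OF y] yv by (auto simp: linear_between_def)
    have "nw ((S ^^ Suc n) x - h - (T ^^ Suc n) ?u)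
        \<le> nw (S ?y - h - T (?y - h)) + nw (T (?y - h - ?v))"
      unfolding split using mem P_sub(1)[OF S_mem[OF y]] subspace_diff[OF Vw(1)] Vw(2)
      by (intro normed_subspace_triangle[OF Bw]) auto
    also have "\<dots> \<le> \<eta> / (2 * R ^ n) * ns (?y - h) + R' * nw (?y - h - ?v)"
    proof (rule add_mono)
      show "nw (S ?y - h - T (?y - h)) \<le> \<eta> / (2 * R ^ n) * ns (?y - h)"
        by (rule \<rho>\<^sub>2(2)[OF y small])
      show "nw (T (?y - h - ?v)) \<le> R' * nw (?y - h - ?v)"
        using T_bound_w[OF yv] nw_nonneg[of "?y - h - ?v"] yv Vw(2)
        by (auto simp: R'_def algebra_simps)
    qed
    also have "\<dots> \<le> \<eta> / (2 * R ^ n) * (R ^ n * ns ?u) + R' * (\<eta> / (2 * R') * ns ?u)"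
      using growth \<rho>\<^sub>1(2)[OF x(1)] x(2) Suc.prems R
      by (intro add_mono mult_left_mono) (auto simp: \<rho>_def)
    also have "\<dots> = \<eta> * ns ?u"
      using R by (simp add: field_simps)
    finally show ?thesis .
  qed
  ultimately show ?case by blast
qed

section \<open>A Lasota-Yorke inequality along nonlinear orbits\<close>

lemma foldr_L_mem: "set fs \<subseteq> P \<Longrightarrow> g \<in> Bs \<Longrightarrow> foldr L fs g \<in> Bs"
  by (induction fs) (auto intro: L_mem)

lemma foldr_L_add:
  "set fs \<subseteq> P \<Longrightarrow> g \<in> Bs \<Longrightarrow> g' \<in> Bs \<Longrightarrow> foldr L fs (g + g') = foldr L fs g + foldr L fs g'"
proof (induction fs)
  case (Cons f fs)
  then show ?case
    using L_Bs[of f] foldr_L_mem[of fs] by (simp add: linear_between_def)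
qed simp

text \<open>Powers of \<open>lam\<close> are at most 1, so products of every length share one strong
  bound. It is applied to the forcing terms, which arise at all times along an orbit.\<close>

lemma lasota_yorke_crude:
  assumes "set fs \<subseteq> P" "g \<in> Bs"
  shows "ns (foldr L fs g) \<le> (A + B) * ns g"
proof -
  have "A * lam ^ length fs * ns g \<le> A * 1 * ns g"
    using const_bounds ns_nonneg[OF assms(2)] by (intro mult_right_mono mult_left_mono power_le_one) auto
  moreover have "B * nw g \<le> B * ns g"
    using const_bounds nw_le_ns[OF assms(2)] by (intro mult_left_mono)
  ultimately show ?thesis
    using lasota_yorke[OF assms] by (simp add: algebra_simps)
qed

text \<open>
  Carrying the list \<open>fs\<close> of further operators through the induction replaces the
  variation-of-constants sum by a scalar one.
\<close>

lemma foldr_L_orbit: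
  assumes "x \<in> P" "set fs \<subseteq> P"
  shows "ns (foldr L fs ((S ^^ n) x - h))
    \<le> ns (foldr L (fs @ rev (map (\<lambda>j. (S ^^ j) x) [0..<n])) (x - h))
      + (A + B) * c * (\<Sum>j<n. nw ((S ^^ j) x - h))"
  using assms(2)
proof (induction n arbitrary: fs)
  case (Suc n)
  let ?y = "(S ^^ n) x"
  have y: "?y \<in> P"
    using assms(1) by (rule S_iterate_mem)
  \<comment> \<open>\<open>foldr\<close> applies the last list entry first. Hence the operator at
    \<open>?y\<close>, which acts before those in \<open>fs\<close>, is appended at the end, and the
    orbit appears in reversed order.\<close>
  have "foldr L fs ((S ^^ Suc n) x - h)
      = foldr L (fs @ [?y]) (?y - h) + foldr L fs (L ?y h - h)"
    unfolding foldr_append foldr.simps o_apply id_apply funpow.simps S_step[OF y]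
    by (rule foldr_L_add[OF Suc.prems L_mem[OF y P_sub(2)[OF y]] forcing_mem[OF y]])
  then have "ns (foldr L fs ((S ^^ Suc n) x - h))
      \<le> ns (foldr L (fs @ [?y]) (?y - h)) + ns (foldr L fs (L ?y h - h))"
    using y Suc.prems P_sub(2)[OF y] forcing_mem[OF y]
    by (auto intro!: normed_subspace_triangle[OF Bs] foldr_L_mem L_mem)
  also have "ns (foldr L fs (L ?y h - h)) \<le> (A + B) * c * nw (?y - h)"
  proof -
    have "(A + B) * ns (L ?y h - h) \<le> (A + B) * (c * nw (?y - h))"
      using const_bounds lipschitz_s[OF y] by (intro mult_left_mono) auto
    then show ?thesis
      using lasota_yorke_crude[OF Suc.prems forcing_mem[OF y]] by (simp add: mult.assoc)
  qed
  also have "ns (foldr L (fs @ [?y]) (?y - h))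
      \<le> ns (foldr L ((fs @ [?y]) @ rev (map (\<lambda>j. (S ^^ j) x) [0..<n])) (x - h))
        + (A + B) * c * (\<Sum>j<n. nw ((S ^^ j) x - h))"
    using Suc.prems y by (intro Suc.IH) auto
  finally show ?case
    by (simp add: algebra_simps)
qed simp

text \<open>The case of no further operators, with the product along the orbit estimated by the
  sequential inequality. Apart from the decaying initial term, the strong norm is thus controlled by
  weak norms along the orbit.\<close>

lemma orbit_lasota_yorke:
  assumes "x \<in> P"
  shows "ns ((S ^^ n) x - h) \<le> A * lam ^ n * ns (x - h) + B * nw (x - h)
    + (A + B) * c * (\<Sum>j<n. nw ((S ^^ j) x - h))"
proof -
  have "set (rev (map (\<lambda>j. (S ^^ j) x) [0..<n])) \<subseteq> P"
    using S_iterate_mem[OF assms] by auto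
  from lasota_yorke[OF this P_sub(2)[OF assms]] show ?thesis
    using foldr_L_orbit[OF assms, of "[]" n] by simp
qed

section \<open>Weak decay and strong contraction near the fixed point\<close>

text \<open>At each time \<open>j < n\<close> the nonlinear error is allowed to be as large as the
  linear bound \<open>K * \<theta> ^ j\<close>, which explains the factor 2. Finitely many times are
  involved, so a common positive radius exists.\<close>

lemma orbit_weak_decay:
  assumes K: "0 < K" "0 < \<theta>" "\<theta> < 1"
    and T_decay: "\<And>g n. g \<in> Vw \<inter> Bs \<Longrightarrow> ns ((T ^^ n) g) \<le> K * \<theta> ^ n * ns g"
  shows "\<exists>\<rho>>0. \<forall>x\<in>P. ns (x - h) \<le> \<rho> \<longrightarrow>
    (\<forall>j<n. nw ((S ^^ j) x - h) \<le> 2 * K * \<theta> ^ j * ns (x - h))"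
proof (induction n)
  case 0
  then show ?case by (auto intro: exI[of _ 1])
next
  case (Suc n)
  obtain \<rho>\<^sub>1 where \<rho>\<^sub>1: "\<rho>\<^sub>1 > 0" "\<forall>x\<in>P. ns (x - h) \<le> \<rho>\<^sub>1 \<longrightarrow>
    (\<forall>j<n. nw ((S ^^ j) x - h) \<le> 2 * K * \<theta> ^ j * ns (x - h))"
    using Suc by blast
  obtain \<rho>\<^sub>2 where \<rho>\<^sub>2: "\<rho>\<^sub>2 > 0" "\<And>x. x \<in> P \<Longrightarrow> ns (x - h) \<le> \<rho>\<^sub>2 \<Longrightarrow>
    nw ((S ^^ n) x - h - (T ^^ n) (x - h)) \<le> K * \<theta> ^ n * ns (x - h)"
    using S_iterate_weak_differentiable[of "K * \<theta> ^ n" n] K by auto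
  have "nw ((S ^^ n) x - h) \<le> 2 * K * \<theta> ^ n * ns (x - h)"
    if x: "x \<in> P" "ns (x - h) \<le> \<rho>\<^sub>2" for x
  proof -
    let ?v = "(T ^^ n) (x - h)"
    have v: "?v \<in> Vw \<inter> Bs"
      using T_Bs P_sub(1,2)[OF x(1)] by (intro funpow_mem[of "Vw \<inter> Bs"]) auto
    have "nw (((S ^^ n) x - h - ?v) + ?v) \<le> nw ((S ^^ n) x - h - ?v) + nw ?v"
      using v P_sub(1)[OF S_iterate_mem[OF x(1)], of n] subspace_diff[OF Vw(1)] Vw(2)
      by (intro normed_subspace_triangle[OF Bw]) auto
    then show ?thesis
      using \<rho>\<^sub>2(2)[OF x] nw_le_ns[of ?v] v T_decay[of "x - h" n] P_sub(1,2)[OF x(1)]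
      by (simp add: algebra_simps)
  qed
  then show ?case
    using \<rho>\<^sub>1 \<rho>\<^sub>2(1) by (intro exI[of _ "min \<rho>\<^sub>1 \<rho>\<^sub>2"]) (auto simp: less_Suc_eq)
qed

text \<open>Two blocks of \<open>m\<close> steps are used. The first costs a strong factor
  \<open>M m\<close> of only linear growth in \<open>m\<close>; during the second all weak norms are
  of order \<open>\<theta> ^ m\<close>. The orbit inequality on the second block then gives the
  factor \<open>F m\<close>, which tends to 0 because exponentials beat linear growth.\<close>

lemma iterate_contracts_ball:
  assumes K: "0 < K" "0 < \<theta>" "\<theta> < 1"
    and T_decay: "\<And>g n. g \<in> Vw \<inter> Bs \<Longrightarrow> ns ((T ^^ n) g) \<le> K * \<theta> ^ n * ns g"
  shows "\<exists>N>0. \<exists>\<rho>>0. \<forall>x\<in>P. ns (x - h) \<le> \<rho> \<longrightarrow> ns ((S ^^ N) x - h) \<le> 1 / 2 * ns (x - h)"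
proof -
  define M where "M m = A + B + (A + B) * c * (real m * (2 * K))" for m
  define F where "F m = A * lam ^ m * M m + B * (2 * K * \<theta> ^ m)
    + (A + B) * c * (real m * (2 * K * \<theta> ^ m))" for m
  have lim: "(\<lambda>m. lam ^ m) \<longlonglongrightarrow> 0" "(\<lambda>m. real m * lam ^ m) \<longlonglongrightarrow> 0"
    "(\<lambda>m. \<theta> ^ m) \<longlonglongrightarrow> 0" "(\<lambda>m. real m * \<theta> ^ m) \<longlonglongrightarrow> 0"
    using const_bounds K by (auto intro!: LIMSEQ_power_zero powser_times_n_limit_0)
  have "(\<lambda>m. A * (A + B) * lam ^ m + A * (A + B) * c * 2 * K * (real m * lam ^ m)
      + B * 2 * K * \<theta> ^ m + (A + B) * c * 2 * K * (real m * \<theta> ^ m)) \<longlonglongrightarrow> 0"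
    by (intro tendsto_add_zero tendsto_mult_right_zero lim)
  then have "F \<longlonglongrightarrow> 0"
    by (rule Lim_transform_eventually) (auto simp: F_def M_def algebra_simps)
  then have "eventually (\<lambda>m. F m < 1 / 2 \<and> 1 \<le> m) sequentially"
    by (intro eventually_conj order_tendstoD(2)[of F 0] eventually_ge_at_top) auto
  then obtain m where m: "F m < 1 / 2" "1 \<le> m"
    using eventually_happens'[OF sequentially_bot] by blast
  obtain \<rho> where \<rho>: "\<rho> > 0" "\<And>x j. x \<in> P \<Longrightarrow> ns (x - h) \<le> \<rho> \<Longrightarrow> j < m + m \<Longrightarrow>
      nw ((S ^^ j) x - h) \<le> 2 * K * \<theta> ^ j * ns (x - h)"
    using orbit_weak_decay[OF K T_decay, of "m + m"] by blast
  have "ns ((S ^^ (m + m)) x - h) \<le> 1 / 2 * ns (x - h)" if x: "x \<in> P" "ns (x - h) \<le> \<rho>" for x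
  proof -
    let ?s = "ns (x - h)" and ?y = "(S ^^ m) x"
    have s: "0 \<le> ?s"
      using ns_nonneg[OF P_sub(2)[OF x(1)]] .
    have y: "?y \<in> P"
      using x(1) by (rule S_iterate_mem)
    \<comment> \<open>The exponent may be lowered: \<open>i = 0\<close> serves the first block,
      \<open>i = m\<close> the second.\<close>
    have decay: "nw ((S ^^ j) x - h) \<le> 2 * K * \<theta> ^ i * ?s" if "j < m + m" "i \<le> j" for i j
    proof -
      have "2 * K * \<theta> ^ j * ?s \<le> 2 * K * \<theta> ^ i * ?s"
        using K s that by (intro mult_right_mono mult_left_mono power_decreasing) auto
      then show ?thesis
        using \<rho>(2)[OF x that(1)] by linarith
    qed
    have ym: "ns (?y - h) \<le> M m * ?s"
    proof -
      have "(\<Sum>j<m. nw ((S ^^ j) x - h)) \<le> real m * (2 * K * ?s)"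
        using sum_mono[of "{..<m}" "\<lambda>j. nw ((S ^^ j) x - h)" "\<lambda>_. 2 * K * ?s"] decay[of _ 0]
        by simp
      then have "(A + B) * c * (\<Sum>j<m. nw ((S ^^ j) x - h)) \<le> (A + B) * c * (real m * (2 * K * ?s))"
        using const_bounds by (intro mult_left_mono) auto
      moreover have "A * lam ^ m * ?s \<le> A * 1 * ?s"
        using const_bounds s by (intro mult_right_mono mult_left_mono power_le_one) auto
      moreover have "B * nw (x - h) \<le> B * ?s"
        using const_bounds nw_le_ns[OF P_sub(2)[OF x(1)]] by (intro mult_left_mono)
      ultimately show ?thesis
        using orbit_lasota_yorke[OF x(1), of m] by (simp add: M_def algebra_simps)
    qed
    have "(\<Sum>j<m. nw ((S ^^ j) ?y - h)) \<le> (\<Sum>j<m. 2 * K * \<theta> ^ m * ?s)"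
    proof (rule sum_mono)
      fix j assume "j \<in> {..<m}"
      then show "nw ((S ^^ j) ?y - h) \<le> 2 * K * \<theta> ^ m * ?s"
        using decay[of "j + m" m] by (simp add: funpow_add)
    qed
    then have "(A + B) * c * (\<Sum>j<m. nw ((S ^^ j) ?y - h))
        \<le> (A + B) * c * (real m * (2 * K * \<theta> ^ m * ?s))"
      using const_bounds by (intro mult_left_mono) auto
    moreover have "A * lam ^ m * ns (?y - h) \<le> A * lam ^ m * (M m * ?s)"
      using const_bounds ym by (intro mult_left_mono) auto
    moreover have "B * nw (?y - h) \<le> B * (2 * K * \<theta> ^ m * ?s)"
      using const_bounds m(2) by (intro mult_left_mono decay) auto
    ultimately have "ns ((S ^^ m) ?y - h) \<le> F m * ?s"
      using orbit_lasota_yorke[OF y, of m] by (simp add: F_def algebra_simps)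
    also have "\<dots> \<le> 1 / 2 * ?s"
      using m(1) s by (intro mult_right_mono) auto
    finally show ?thesis
      by (simp add: funpow_add)
  qed
  then show ?thesis
    using m(2) \<rho>(1) by (intro exI[of _ "m + m"] conjI exI[of _ \<rho>]) auto
qed

text \<open>The decay lemma is used twice: for \<open>T\<close> on \<open>Vw \<inter> Bs\<close>,
  which yields the decay needed to contract a ball, and then for \<open>S\<close> on that
  ball.\<close>

theorem local_exponential_contraction:
  assumes r: "0 < r" "r < 1"
    and contr: "\<And>g. g \<in> Vw \<inter> Bs \<Longrightarrow> ns ((T ^^ n\<^sub>0) g) \<le> r * ns g"
  shows "\<exists>\<epsilon>>0. \<exists>\<gamma>>0. \<exists>K>0. \<forall>x\<in>P. ns (x - h) \<le> \<epsilon> \<longrightarrow>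
    (\<forall>n. ns ((S ^^ n) x - h) \<le> K * exp (- \<gamma> * real n) * ns (x - h))"
proof -
  \<comment> \<open>The exponent in the hypothesis may be 0, whereas the decay lemma needs a
    positive block length.\<close>
  define n\<^sub>1 where "n\<^sub>1 = max 1 n\<^sub>0"
  have contr': "ns ((T ^^ n\<^sub>1) g) \<le> r * ns g" if g: "g \<in> Vw \<inter> Bs" for g
  proof (cases "n\<^sub>0 = 0")
    case True
    \<comment> \<open>The hypothesis with exponent 0 forces the strong norm to vanish on the subspace.\<close>
    then have "ns g' = 0" if "g' \<in> Vw \<inter> Bs" for g'
      using contr[OF that] r ns_nonneg[of g'] that mult_less_cancel_right2[of r "ns g'"] by force
    then show ?thesis
      using g T_Bs[OF g] True by (simp add: n\<^sub>1_def)
  next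
    case False
    then show ?thesis
      using contr[OF g] by (simp add: n\<^sub>1_def max_def)
  qed
  have T_growth: "ns ((T ^^ j) g) \<le> (C + d + 1) ^ j * ns g" if g: "g \<in> Vw \<inter> Bs" for g j
  proof (induction j)
    case (Suc j)
    have "ns (T ((T ^^ j) g)) \<le> (C + d + 1) * ns ((T ^^ j) g)"
      by (intro T_bound_s funpow_mem[of "Vw \<inter> Bs"] T_Bs g)
    also have "\<dots> \<le> (C + d + 1) * ((C + d + 1) ^ j * ns g)"
      using Suc const_bounds by (intro mult_left_mono) auto
    finally show ?case
      by (simp add: mult.assoc)
  qed simp
  have "\<exists>\<gamma>>0. \<exists>K>0. \<forall>g\<in>Vw \<inter> Bs. \<forall>n. ns ((T ^^ n) g) \<le> K * exp (- \<gamma> * real n) * ns g"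
    using r contr' T_growth ns_nonneg const_bounds
    by (intro exponential_decay_of_contracting_iterate[where N = n\<^sub>1 and r = r and R = "C + d + 1"])
       (auto simp: n\<^sub>1_def intro: funpow_mem[of "Vw \<inter> Bs" T, OF T_Bs, THEN IntD1]
          funpow_mem[of "Vw \<inter> Bs" T, OF T_Bs, THEN IntD2])
  then obtain \<gamma> K where \<gamma>K: "\<gamma> > 0" "K > 0"
    "\<And>g n. g \<in> Vw \<inter> Bs \<Longrightarrow> ns ((T ^^ n) g) \<le> K * exp (- \<gamma>) ^ n * ns g"
    by (auto simp: exp_of_nat_mult[symmetric] mult.commute)
  obtain N \<rho> where N: "N > 0" "\<rho> > 0"
    "\<And>x. x \<in> P \<Longrightarrow> ns (x - h) \<le> \<rho> \<Longrightarrow> ns ((S ^^ N) x - h) \<le> 1 / 2 * ns (x - h)"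
    using iterate_contracts_ball[of K "exp (- \<gamma>)"] \<gamma>K by auto
  \<comment> \<open>\<open>S ^^ N\<close> maps this ball into itself; at intermediate times the
    orbit may leave it and is controlled by \<open>S_growth\<close>.\<close>
  let ?B = "{x \<in> P. ns (x - h) \<le> \<rho>}"
  have "\<exists>\<gamma>>0. \<exists>K>0. \<forall>x\<in>?B. \<forall>n. ns ((S ^^ n) x - h) \<le> K * exp (- \<gamma> * real n) * ns (x - h)"
  proof (rule exponential_decay_of_contracting_iterate[where r = "1 / 2" and R = "C + c + 1"])
    fix x assume x: "x \<in> ?B"
    then have "ns ((S ^^ N) x - h) \<le> ns (x - h)"
      using N(3)[of x] ns_nonneg[of "x - h"] P_sub(2)[of x] by auto
    then show "(S ^^ N) x \<in> ?B"
      using x S_iterate_mem[of x N] by auto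
  qed (use N S_growth const_bounds ns_nonneg P_sub in auto)
  with N(2) show ?thesis
    by fastforce
qed

end

section \<open>Normalizing the Lasota-Yorke rate\<close>

text \<open>
  A negative \<open>lam\<^sub>0\<close> may have absolute value above 1, but then the inequality for a single operator makes
  the strong norm dominated by the weak one.
\<close>

lemma lasota_yorke_nonneg_rate:
  fixes L :: "'v::real_vector \<Rightarrow> 'v \<Rightarrow> 'v"
  assumes Bs: "normed_subspace Bs ns"
    and Q: "h \<in> Q" and inv: "\<And>f g. f \<in> Q \<Longrightarrow> g \<in> Bs \<Longrightarrow> L f g \<in> Bs"
    and lam: "lam\<^sub>0 < 1" and AB: "0 < A" "0 < B"
    and ly: "\<And>fs g. set fs \<subseteq> Q \<Longrightarrow> g \<in> Bs \<Longrightarrow> nw (foldr L fs g) \<le> B * nw g \<and>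
      ns (foldr L fs g) \<le> A * lam\<^sub>0 ^ length fs * ns g + B * nw g"
  obtains lam A' B' :: real where "0 \<le> lam" "lam < 1" "0 \<le> A'" "0 \<le> B'"
    "\<And>fs g. set fs \<subseteq> Q \<Longrightarrow> g \<in> Bs \<Longrightarrow>
      ns (foldr L fs g) \<le> A' * lam ^ length fs * ns g + B' * nw g"
proof (cases "0 \<le> lam\<^sub>0")
  case True
  then show ?thesis
    using that[of lam\<^sub>0 A B] lam AB ly by auto
next
  case False
  \<comment> \<open>The first factor dominates the strong norm by the weak one, and the second
    bounds products in the weak norm. No strong term remains, so rate and coefficient can both be
    0.\<close>
  define B' where "B' = B / (A * (- lam\<^sub>0)) * B"
  have "ns (foldr L fs g) \<le> 0 * 0 ^ length fs * ns g + B' * nw g"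
    if fs: "set fs \<subseteq> Q" and g: "g \<in> Bs" for fs g
  proof -
    have mem: "foldr L fs g \<in> Bs"
      using fs by (induction fs) (auto intro: inv g)
    have dom: "ns g' \<le> B / (A * (- lam\<^sub>0)) * nw g'" if g': "g' \<in> Bs" for g'
    proof -
      have "0 \<le> ns (L h g')"
        using normed_subspace_nonneg[OF Bs inv[OF Q g']] .
      then have "A * (- lam\<^sub>0) * ns g' \<le> B * nw g'"
        using ly[of "[h]" g'] Q g' by simp
      moreover have "0 < A * (- lam\<^sub>0)"
        using AB False by (simp add: mult_pos_neg)
      ultimately have "ns g' \<le> B * nw g' / (A * (- lam\<^sub>0))"
        by (metis mult.commute pos_le_divide_eq)
      then show ?thesis
        by simp
    qed
    have "ns (foldr L fs g) \<le> B / (A * (- lam\<^sub>0)) * nw (foldr L fs g)"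
      by (rule dom[OF mem])
    also have "\<dots> \<le> B / (A * (- lam\<^sub>0)) * (B * nw g)"
      using ly[OF fs g] AB False by (intro mult_left_mono divide_nonneg_nonneg) (auto simp: mult_le_0_iff)
    finally show ?thesis
      by (simp add: B'_def mult.assoc)
  qed
  moreover have "0 \<le> B'"
    unfolding B'_def using AB False by (intro mult_nonneg_nonneg divide_nonneg_nonneg) auto
  ultimately show ?thesis
    using that[of 0 0 B'] by auto
qed

section \<open>From measures to the abstract system\<close>

theorem proposition5:
  fixes Bss Bs Bw :: "'a::metric_space smeasure set"
    and nss ns nw :: "'a smeasure \<Rightarrow> real"
    and \<delta> :: real
    and L :: "'a smeasure \<Rightarrow> 'a smeasure \<Rightarrow> 'a smeasure"
    and h :: "'a smeasure"
    and D :: "'a smeasure \<Rightarrow> 'a smeasure"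
  assumes spaces: "normed_subspace Bss nss" "normed_subspace Bs ns" "normed_subspace Bw nw"
    and incl: "Bss \<subseteq> Bs" "Bs \<subseteq> Bw"
    and norms: "\<forall>\<mu>\<in>Bss. ns \<mu> \<le> nss \<mu>" "\<forall>\<mu>\<in>Bs. nw \<mu> \<le> ns \<mu>"
    and \<delta>: "\<delta> \<ge> 0"
    and markov: "\<forall>f\<in>Bw. markov_operator Bw (L f) \<and> bounded_linear_between Bw nw Bw nw (L f)
                        \<and> L f ` Bs \<subseteq> Bs \<and> L f ` Bss \<subseteq> Bss"
    and fixed_point: "h \<in> Bss \<inter> (borel_probs \<inter> Bw)" "self_consistent L h = h"
    and boundedness:
      "\<exists>C\<ge>0. \<forall>f\<in>Bw. op_norm Bw nw nw (L f) \<le> ereal C \<and> op_norm Bs ns ns (L f) \<le> ereal C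
                       \<and> op_norm Bss nss nss (L f) \<le> ereal C"
    and lasota_yorke:
      "\<exists>lam\<^sub>0 A B :: real. lam\<^sub>0 < 1 \<and> A > 0 \<and> B > 0 \<and>
         (\<forall>n. \<forall>fs. length fs = n \<longrightarrow> set fs \<subseteq> borel_probs \<inter> Bw \<longrightarrow> (\<forall>g\<in>Bs.
            nw (foldr L fs g) \<le> B * nw g \<and>
            ns (foldr L fs g) \<le> A * lam\<^sub>0 ^ n * ns g + B * nw g))"
    and convergence_to_equilibrium:
      "\<exists>a :: nat \<Rightarrow> real. (\<forall>n. a n \<ge> 0) \<and> a \<longlonglongrightarrow> 0 \<and>
         (\<forall>n. \<forall>\<mu>\<in>zero_mass Bs. nw ((L h ^^ n) \<mu>) \<le> a n * ns \<mu>)"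
    and regularity_s:
      "\<exists>C\<^sub>0>0. \<forall>f\<in>Bs. \<forall>g\<in>Bs. ns (L f h - L g h) \<le> \<delta> * C\<^sub>0 * nss h * nw (f - g)"
    and regularity_w:
      "\<exists>C\<^sub>1>0. \<forall>f\<^sub>1\<in>Bw. \<forall>f\<^sub>2\<in>Bw. \<forall>g\<in>Bs. nw (L f\<^sub>1 g - L f\<^sub>2 g) \<le> \<delta> * C\<^sub>1 * ns g * nw (f\<^sub>1 - f\<^sub>2)"
    and D_bounded: "bounded_linear_between (zero_mass Bw) nw (zero_mass Bs) ns D"
    and differentiability:
      "((\<lambda>g. ns (L (h + g) h - L h h - D g) / nw g) \<longlongrightarrow> 0)
         (nw going_to at_right 0 within zero_mass Bw)"
    and D_strong: "bounded_linear_between (zero_mass Bw) nw Bss nss D"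
    and contraction:
      "\<exists>n. \<exists>lam::real. 0 < lam \<and> lam < 1 \<and>
         (\<forall>g\<in>zero_mass Bs. ns (((\<lambda>u. L h u + D u) ^^ n) g) \<le> lam * ns g)"
  shows "\<exists>\<epsilon>>0. \<exists>\<gamma>>0. \<exists>K>0. \<forall>\<mu>\<in>borel_probs \<inter> Bs. ns (h - \<mu>) \<le> \<epsilon> \<longrightarrow>
           (\<forall>n::nat. ns (h - (self_consistent L ^^ n) \<mu>) \<le> K * exp (- \<gamma> * real n) * ns (h - \<mu>))"
proof -
  let ?P = "borel_probs \<inter> Bs" and ?V = "zero_mass Bw"
  have h: "h \<in> Bss" "h \<in> ?P" "h \<in> Bw" "L h h = h"
    using fixed_point incl by (auto simp: self_consistent_def)
  have lin_w: "linear_between Bw Bw (L f)"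
    and pos: "\<And>g. g \<in> Bw \<Longrightarrow> positive_smeasure g \<Longrightarrow> positive_smeasure (L f g)"
    and mass: "\<And>g. g \<in> Bw \<Longrightarrow> total_mass (L f g) = total_mass g"
    and L_Bs: "L f ` Bs \<subseteq> Bs" if "f \<in> Bw" for f
    using bspec[OF markov that] unfolding markov_operator_def by blast+
  have lin_s: "linear_between Bs Bs (L f)" if "f \<in> Bw" for f
    using lin_w[OF that] L_Bs[OF that] incl(2) unfolding linear_between_def by blast
  obtain C where "0 \<le> C" and C: "\<And>f. f \<in> Bw \<Longrightarrow> op_norm Bw nw nw (L f) \<le> ereal C"
    "\<And>f. f \<in> Bw \<Longrightarrow> op_norm Bs ns ns (L f) \<le> ereal C"
    using boundedness by blast
  have L_bound_w: "nw (L f g) \<le> C * nw g" if "f \<in> Bw" "g \<in> Bw" for f g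
    using C(1)[OF that(1)] that op_norm_le_iff[OF spaces(3,3) lin_w \<open>0 \<le> C\<close>] by blast
  have L_bound_s: "ns (L f g) \<le> C * ns g" if "f \<in> Bw" "g \<in> Bs" for f g
    using C(2)[OF that(1)] that op_norm_le_iff[OF spaces(2,2) lin_s \<open>0 \<le> C\<close>] by blast
  obtain C\<^sub>0 where C\<^sub>0: "0 < C\<^sub>0"
    "\<And>f g. f \<in> Bs \<Longrightarrow> g \<in> Bs \<Longrightarrow> ns (L f h - L g h) \<le> \<delta> * C\<^sub>0 * nss h * nw (f - g)"
    using regularity_s by blast
  obtain C\<^sub>1 where C\<^sub>1: "0 < C\<^sub>1" "\<And>f\<^sub>1 f\<^sub>2 g. f\<^sub>1 \<in> Bw \<Longrightarrow> f\<^sub>2 \<in> Bw \<Longrightarrow> g \<in> Bs \<Longrightarrow>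
    nw (L f\<^sub>1 g - L f\<^sub>2 g) \<le> \<delta> * C\<^sub>1 * ns g * nw (f\<^sub>1 - f\<^sub>2)"
    using regularity_w by blast
  have V: "normed_subspace ?V nw"
    using spaces(3) by (rule zero_mass_normed_subspace)
  have Vs: "normed_subspace (zero_mass Bs) ns" "zero_mass Bs = ?V \<inter> Bs"
    using zero_mass_normed_subspace[OF spaces(2)] incl by (auto simp: zero_mass_def)
  obtain d where d: "0 \<le> d" "\<forall>g\<in>?V. ns (D g) \<le> d * nw g"
    using bounded_linear_betweenE[OF V Vs(1) D_bounded] .
  have D_lin: "linear_between ?V (?V \<inter> Bs) D"
    using D_bounded Vs(2) by (simp add: bounded_linear_between_def)
  obtain lam\<^sub>0 A\<^sub>0 B\<^sub>0 :: real where ly\<^sub>0: "lam\<^sub>0 < 1" "0 < A\<^sub>0" "0 < B\<^sub>0" and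
    ly: "\<forall>n. \<forall>fs. length fs = n \<longrightarrow> set fs \<subseteq> borel_probs \<inter> Bw \<longrightarrow> (\<forall>g\<in>Bs.
      nw (foldr L fs g) \<le> B\<^sub>0 * nw g \<and>
      ns (foldr L fs g) \<le> A\<^sub>0 * lam\<^sub>0 ^ n * ns g + B\<^sub>0 * nw g)"
    using lasota_yorke by (elim exE conjE)
  have ly\<^sub>0': "nw (foldr L fs g) \<le> B\<^sub>0 * nw g \<and>
      ns (foldr L fs g) \<le> A\<^sub>0 * lam\<^sub>0 ^ length fs * ns g + B\<^sub>0 * nw g"
    if "set fs \<subseteq> borel_probs \<inter> Bw" "g \<in> Bs" for fs g
    using ly[rule_format, OF refl that] .
  have h_mem: "h \<in> borel_probs \<inter> Bw"
    using fixed_point by blast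
  have L_mem: "L f g \<in> Bs" if "f \<in> borel_probs \<inter> Bw" "g \<in> Bs" for f g
    using L_Bs[of f] that by blast
  obtain lam A B :: real where ly: "0 \<le> lam" "lam < 1" "0 \<le> A" "0 \<le> B"
    "\<And>fs g. set fs \<subseteq> borel_probs \<inter> Bw \<Longrightarrow> g \<in> Bs \<Longrightarrow>
      ns (foldr L fs g) \<le> A * lam ^ length fs * ns g + B * nw g"
    using lasota_yorke_nonneg_rate[where L = L and ns = ns and nw = nw,
      OF spaces(2) h_mem L_mem ly\<^sub>0 ly\<^sub>0'] by blast
  have diff: "\<exists>\<rho>>0. \<forall>x\<in>?P. nw (x - h) \<le> \<rho> \<longrightarrow> ns (L x h - h - D (x - h)) \<le> \<eta> * nw (x - h)"
    if \<eta>: "0 < \<eta>" for \<eta>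
  proof -
    have "eventually (\<lambda>g. ns (L (h + g) h - L h h - D g) / nw g < \<eta>)
        (nw going_to at_right 0 within ?V)"
      using order_tendstoD(2)[OF differentiability \<eta>] .
    then obtain b where b: "b > 0"
      "\<And>g. g \<in> ?V \<Longrightarrow> 0 < nw g \<Longrightarrow> nw g < b \<Longrightarrow> ns (L (h + g) h - L h h - D g) / nw g < \<eta>"
      unfolding going_to_within_def eventually_inf_principal eventually_filtercomap
        eventually_at_right_field by blast
    \<comment> \<open>The limit speaks only of \<open>0 < nw g < b\<close>. Hence
      \<open>x = h\<close> is treated separately, and \<open>b / 2\<close> turns the strict bound
      into a non-strict one.\<close>
    have "ns (L x h - h - D (x - h)) \<le> \<eta> * nw (x - h)" if x: "x \<in> ?P" "nw (x - h) \<le> b / 2" for x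
    proof (cases "x = h")
      case True
      have "D 0 = 0" "ns 0 = 0" "nw 0 = 0"
        using linear_between_zero[OF D_lin normed_subspace_imp_subspace[OF V]] spaces
          subspace_0[of Bs] subspace_0[of Bw] by (auto simp: normed_subspace_def)
      then show ?thesis
        using True h(4) by simp
    next
      case False
      have "x - h \<in> Bw"
        using x(1) h(3) incl(2) by (intro subspace_diff[OF normed_subspace_imp_subspace[OF spaces(3)]]) auto
      then have u: "x - h \<in> ?V"
        using x(1) h(2) by (auto simp: zero_mass_def total_mass_diff borel_probs_iff)
      then have "0 < nw (x - h)"
        using False V normed_subspace_nonneg[OF V u] by (auto simp: normed_subspace_def less_le)
      then show ?thesis
        using b(2)[OF u] x(2) b(1) h(4) by (simp add: pos_divide_less_eq)
    qed
    then show ?thesis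
      using b(1) by (intro exI[of _ "b / 2"]) auto
  qed
  \<comment> \<open>The forcing constant comes from strong regularity at the pair \<open>x\<close>,
    \<open>h\<close> together with \<open>L h h = h\<close>; it is nonnegative because
    \<open>h \<in> Bss\<close>. Differences of probability measures have mass 0, and the Markov
    property keeps \<open>L x x\<close> a probability measure.\<close>
  interpret sys: self_consistent_system Bs Bw ?V ?P ns nw L h D
    C "\<delta> * C\<^sub>0 * nss h" "\<delta> * C\<^sub>1" d A B lam
  proof
    show "subspace ?V" "?V \<subseteq> Bw"
      using V by (auto simp: normed_subspace_def zero_mass_def)
    show "x - y \<in> ?V" if "x \<in> ?P" "y \<in> ?P" for x y
      using that incl(2) subspace_diff[OF normed_subspace_imp_subspace[OF spaces(3)], of x y]
      by (auto simp: zero_mass_def total_mass_diff borel_probs_iff)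
    show "L x x \<in> ?P" if "x \<in> ?P" for x
      using that incl(2) pos[of x x] mass[of x x] L_Bs[of x]
      by (auto simp: borel_probs_iff image_subset_iff)
    show "linear_between ?V ?V (L h)"
      using lin_w[OF h(3)] mass[OF h(3)] by (auto simp: linear_between_def zero_mass_def)
    show "0 \<le> \<delta> * C\<^sub>0 * nss h" "0 \<le> \<delta> * C\<^sub>1"
      using \<delta> C\<^sub>0(1) C\<^sub>1(1) normed_subspace_nonneg[OF spaces(1) h(1)] by auto
    show "ns (foldr L fs g) \<le> A * lam ^ length fs * ns g + B * nw g"
      if "set fs \<subseteq> ?P" "g \<in> Bs" for fs g
      using ly(5)[of fs g] that incl(2) by auto
    show "ns (L x h - h) \<le> \<delta> * C\<^sub>0 * nss h * nw (x - h)" if "x \<in> ?P" for x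
      using C\<^sub>0(2)[of x h] that h by auto
    show "linear_between Bs Bs (L x)" if "x \<in> ?P" for x
      using that incl(2) by (intro lin_s) auto
    show "ns (L x g) \<le> C * ns g" if "x \<in> ?P" "g \<in> Bs" for x g
      using that incl(2) by (intro L_bound_s) auto
    show "nw (L h g) \<le> C * nw g" if "g \<in> ?V" for g
      using that h(3) by (intro L_bound_w) (auto simp: zero_mass_def)
    show "nw (L x g - L h g) \<le> \<delta> * C\<^sub>1 * ns g * nw (x - h)" if "x \<in> ?P" "g \<in> Bs" for x g
      using that incl(2) h(3) by (intro C\<^sub>1(2)) auto
  qed (fact spaces incl(2) h(2,4) \<open>0 \<le> C\<close> d(1) ly(1-4) D_lin diff
      | use norms(2) d(2) in blast)+
  obtain n lam' where lam': "0 < lam'" "lam' < 1"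
    "\<And>g. g \<in> zero_mass Bs \<Longrightarrow> ns (((\<lambda>u. L h u + D u) ^^ n) g) \<le> lam' * ns g"
    using contraction by blast
  have "(\<lambda>u. L h u + D u) = sys.T"
    by (simp add: sys.T_def fun_eq_iff)
  then obtain \<epsilon> \<gamma> K where "0 < \<epsilon>" "0 < \<gamma>" "0 < K" and
    *: "\<And>x n. x \<in> ?P \<Longrightarrow> ns (x - h) \<le> \<epsilon> \<Longrightarrow>
      ns ((self_consistent L ^^ n) x - h) \<le> K * exp (- \<gamma> * real n) * ns (x - h)"
    using sys.local_exponential_contraction[of lam' n] lam' Vs(2) by auto
  moreover have "ns (h - x) = ns (x - h)" if "x \<in> ?P" for x
    using that h(2) by (intro normed_subspace_minus_commute[OF spaces(2)]) auto
  ultimately show ?thesis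
    using sys.S_iterate_mem by (intro exI[of _ \<epsilon>] exI[of _ \<gamma>] exI[of _ K] conjI) simp_all
qed

end
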